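(* Let $m,N\ge1$, let $\mathcal G$ be a finite nonempty set of functions $g:\mathcal X\times\Gamma_N\to[-1,1]$, let $\delta\in(0,1)$, let $Z_1,\dots,Z_m$ be i.i.d. examples from a distribution $\mathcal D$ on $\mathcal X\times\{0,1\}$, and run the approachability algorithm on $\mathcal G$ sequentially on this sample with rate $\eta\in(0,1/4]$. Let $\hat p$ be the resulting randomized historical predictor. Then, with probability at least $1-\delta$ over the training sample and all training randomization, simultaneously for every $g\in\mathcal G$, $$\mathrm{Bias}_{\mathcal D}(g;\hat p)\le5\eta\,\mathrm{Mass}_{\mathcal D}(g;\hat p)+\frac{2\log(12|\mathcal G|/\delta)+2m/N^2}{\eta m}.$$
   Context: $\Gamma_N=\{0,1/N,\dots,1\}$. For a randomized predictor $\hat p$ (mapping $x$ to a distribution on $\Gamma_N$), $$\mathrm{Bias}_{\mathcal D}(g;\hat p)=\mathbb E_{(X,Y)\sim\mathcal D,\,p\sim\hat p(X)}[(Y-p)g(X,p)],\qquad \mathrm{Mass}_{\mathcal D}(g;\hat p)=\mathbb E_{(X,Y)\sim\mathcal D,\,p\sim\hat p(X)}[g(X,p)^2].$$ Approachability algorithm on $\mathcal G$ with rate $\eta$, run on examples $(x_t,y_t)$, $t=1,\dots,m$: initialize $W_1(g)=1/|\mathcal G|$. At round $t$, after observing $x_t$, set $w_t(g)=W_t(g)/\sum_{g'}W_t(g')$ and $F_t(\gamma)=\sum_{g\in\mathcal G}w_t(g)g(x_t,\gamma)$ for $\gamma\in\Gamma_N$. If $F_t(0)\le0$, set $\psi_t=\delta_0$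 (point mass at $0$). Otherwise, if $F_t(1)\ge0$, set $\psi_t=\delta_1$. Otherwise choose adjacent grid points $a<b=a+1/N$ with $F_t(a)\ge0\ge F_t(b)$; if $F_t(a)=0$ or $F_t(b)=0$, let $\psi_t$ be the point mass on an endpoint where $F_t$ is zero; else set $\lambda_t=F_t(a)/(F_t(a)-F_t(b))$ and $\psi_t=(1-\lambda_t)\delta_a+\lambda_t\delta_b$. Draw $p_t\sim\psi_t$, observe $y_t$, and update $$W_{t+1}(g)=W_t(g)\exp\!\big(\eta(y_t-p_t)g(x_t,p_t)-2\eta^2g(x_t,p_t)^2\big).$$ Historical predictor: with $Z_t=(X_t,Y_t)$, before round $t$ the history of rounds $1,\dots,t-1$ determines a map $\pi_t$ sending each $x\in\mathcal X$ to the distribution $\psi_t$ the algorithm would produce at round $t$ on context $x$. The predictor $\hat p$ draws $J$ uniformly from $\{1,\dots,m\}$ and, on input $x$, draws $p\sim\pi_J(x)$, with $J$ and $p$ fresh test-time randomness. *)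

theory Defs
  imports "HOL-Probability.Probability"
begin

definition grid :: "nat \<Rightarrow> real set" where
  "grid N = (\<lambda>k. real k / real N) ` {..N}"

text \<open>
  Law of \<open>((X, Y), p)\<close> where \<open>(X, Y)\<close> has law \<open>D\<close> and, given \<open>(X, Y)\<close>, the prediction \<open>p\<close> is drawn
  from \<open>q X\<close>, a distribution on the grid.  It is given by its density with respect to the product
  of \<open>D\<close> and the counting measure on the grid.
\<close>
definition prediction_law ::
    "nat \<Rightarrow> ('x \<times> real) measure \<Rightarrow> ('x \<Rightarrow> real pmf) \<Rightarrow> (('x \<times> real) \<times> real) measure" where
  "prediction_law N D q =
     density (D \<Otimes>\<^sub>M count_space (grid N)) (\<lambda>((x, y), p). ennreal (pmf (q x) p))"

definition bias ::
    "nat \<Rightarrow> ('x \<times> real) measure \<Rightarrow> ('x \<times> real \<Rightarrow> real) \<Rightarrow> ('x \<Rightarrow> real pmf) \<Rightarrow> real" where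
  "bias N D g q = (\<integral>((x, y), p). (y - p) * g (x, p) \<partial>prediction_law N D q)"

definition mass ::
    "nat \<Rightarrow> ('x \<times> real) measure \<Rightarrow> ('x \<times> real \<Rightarrow> real) \<Rightarrow> ('x \<Rightarrow> real pmf) \<Rightarrow> real" where
  "mass N D g q = (\<integral>((x, y), p). (g (x, p))\<^sup>2 \<partial>prediction_law N D q)"

text \<open>
  Rounds are numbered from \<open>0\<close>.  A history \<open>h\<close> of the first \<open>t\<close> rounds maps each \<open>s < t\<close> to
  \<open>((x\<^sub>s, y\<^sub>s), p\<^sub>s)\<close> and is \<open>undefined\<close> elsewhere.
\<close>
type_synonym 'x history = "nat \<Rightarrow> ('x \<times> real) \<times> real"

definition history_space :: "'x measure \<Rightarrow> nat \<Rightarrow> nat \<Rightarrow> 'x history measure" where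
  "history_space X N t =
     (\<Pi>\<^sub>M s\<in>{..<t}. (X \<Otimes>\<^sub>M count_space {0, 1}) \<Otimes>\<^sub>M count_space (grid N))"

primrec weight ::
    "('x \<times> real \<Rightarrow> real) set \<Rightarrow> real \<Rightarrow> 'x history \<Rightarrow> nat \<Rightarrow> ('x \<times> real \<Rightarrow> real) \<Rightarrow> real" where
  "weight G \<eta> h 0 g = 1 / real (card G)"
| "weight G \<eta> h (Suc t) g =
     (case h t of ((x, y), p) \<Rightarrow>
        weight G \<eta> h t g * exp (\<eta> * (y - p) * g (x, p) - 2 * \<eta>\<^sup>2 * (g (x, p))\<^sup>2))"

definition aggregate ::
    "('x \<times> real \<Rightarrow> real) set \<Rightarrow> real \<Rightarrow> nat \<Rightarrow> 'x history \<Rightarrow> 'x \<Rightarrow> real \<Rightarrow> real" where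
  "aggregate G \<eta> t h x \<gamma> =
     (\<Sum>g\<in>G. weight G \<eta> h t g / (\<Sum>g'\<in>G. weight G \<eta> h t g') * g (x, \<gamma>))"

text \<open>
  \<open>admissible_step N F \<psi>\<close>: the distribution \<open>\<psi>\<close> may be produced from the aggregate \<open>F\<close>.  This is a
  relation since the algorithm leaves open which adjacent grid points with a sign change, and
  which zero among them, are chosen.
\<close>
definition admissible_step :: "nat \<Rightarrow> (real \<Rightarrow> real) \<Rightarrow> real pmf \<Rightarrow> bool" where
  "admissible_step N F \<psi> \<longleftrightarrow>
     (if F 0 \<le> 0 then \<psi> = return_pmf 0
      else if F 1 \<ge> 0 then \<psi> = return_pmf 1
      else \<exists>a\<in>grid N. \<exists>b\<in>grid N. b = a + 1 / real N \<and> F a \<ge> 0 \<and> 0 \<ge> F b \<and>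
        (if F a = 0 \<or> F b = 0 then \<exists>c\<in>{a, b}. F c = 0 \<and> \<psi> = return_pmf c
         else \<psi> = map_pmf (\<lambda>u. if u then b else a) (bernoulli_pmf (F a / (F a - F b)))))"

text \<open>
  \<open>\<pi> t h x\<close> is the distribution produced in round \<open>t\<close> on context \<open>x\<close> after the history \<open>h\<close> of the
  rounds before \<open>t\<close>.  Any resolution of the free choices that is measurable in \<open>(h, x)\<close> is
  allowed.
\<close>
definition approachability_algorithm ::
    "'x measure \<Rightarrow> nat \<Rightarrow> ('x \<times> real \<Rightarrow> real) set \<Rightarrow> real \<Rightarrow> nat \<Rightarrow>
     (nat \<Rightarrow> 'x history \<Rightarrow> 'x \<Rightarrow> real pmf) \<Rightarrow> bool" where
  "approachability_algorithm X N G \<eta> m \<pi> \<longleftrightarrow>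
     (\<forall>t<m. (\<forall>h\<in>space (history_space X N t). \<forall>x\<in>space X.
               admissible_step N (aggregate G \<eta> t h x) (\<pi> t h x)) \<and>
            (\<forall>\<gamma>\<in>grid N. (\<lambda>(h, x). pmf (\<pi> t h x) \<gamma>)
               \<in> borel_measurable (history_space X N t \<Otimes>\<^sub>M X)))"

text \<open>
  Joint law of the sample and the drawn predictions over the first \<open>t\<close> rounds: in each round a
  fresh example is drawn from \<open>D\<close> independently of the history \<open>h\<close>, and the prediction is drawn from
  \<open>\<pi> t h x\<close>, not depending on the label.
\<close>
primrec training_law ::
    "'x measure \<Rightarrow> nat \<Rightarrow> ('x \<times> real) measure \<Rightarrow> (nat \<Rightarrow> 'x history \<Rightarrow> 'x \<Rightarrow> real pmf) \<Rightarrow>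
     nat \<Rightarrow> 'x history measure" where
  "training_law X N D \<pi> 0 = return (history_space X N 0) (\<lambda>_. undefined)"
| "training_law X N D \<pi> (Suc t) =
     training_law X N D \<pi> t \<bind>
       (\<lambda>h. distr (prediction_law N D (\<pi> t h)) (history_space X N (Suc t)) (\<lambda>e. h(t := e)))"

definition historical_predictor ::
    "nat \<Rightarrow> (nat \<Rightarrow> 'x history \<Rightarrow> 'x \<Rightarrow> real pmf) \<Rightarrow> 'x history \<Rightarrow> 'x \<Rightarrow> real pmf" where
  "historical_predictor m \<pi> h x =
     bind_pmf (pmf_of_set {..<m}) (\<lambda>j. \<pi> j (restrict h {..<j}) x)"

end

theory Submission
  imports Defs
begin

text \<open>
  Let \<open>b\<^sub>t\<close> and \<open>M\<^sub>t\<close> be the conditional bias and mass of round \<open>t\<close>, so that \<open>m\<close> times the bias of the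
  historical predictor is \<open>\<Sum>t. b\<^sub>t\<close>, and likewise for the mass.  Both
  \<open>exp (- t / (8 N\<^sup>2)) (\<Sum>g. W\<^sub>t g)\<close> and \<open>exp (\<Sum>s<t. \<eta> b\<^sub>s - 5 \<eta>\<^sup>2 M\<^sub>s) / W\<^sub>t g\<close> are supermartingales: the
  former by the choice of the prediction, the latter because dividing by the weight removes the
  realized gains in favour of their conditional means.  Their combination, normalized to start at
  \<open>2\<close>, is below \<open>2 / \<delta>\<close> with probability \<open>1 - \<delta>\<close> by Markov's inequality, and multiplying the two
  resulting bounds eliminates \<open>W\<^sub>m g\<close>.
\<close>

section \<open>Quadratic bounds for the exponential\<close>

text \<open>With \<open>s = - z\<close>, the product
  \<open>(1 - s + s^2/2) * (1 + s + s^2/2)\<close> is \<open>1 + s^4/4\<close>, hence at least 1,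
  while its second factor is at most \<open>exp s\<close>.\<close>

lemma exp_le_quadratic_nonpos:
  fixes z :: real
  assumes "z \<le> 0"
  shows "exp z \<le> 1 + z + z\<^sup>2 / 2"
proof -
  define s where "s = - z"
  have s: "s \<ge> 0" using assms by (simp add: s_def)
  have pos: "1 - s + s\<^sup>2 / 2 > 0"
    using sum_power2_gt_zero_iff[of "s - 1" 1] by (simp add: power2_eq_square algebra_simps)
  have "1 \<le> 1 + (s\<^sup>2)\<^sup>2 / 4" by simp
  also have "\<dots> = (1 - s + s\<^sup>2 / 2) * (1 + s + s\<^sup>2 / 2)"
    by (simp add: power2_eq_square algebra_simps)
  also have "\<dots> \<le> (1 - s + s\<^sup>2 / 2) * exp s"
    using exp_lower_Taylor_quadratic[OF s] pos by (intro mult_left_mono) auto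
  finally have "exp (- s) \<le> 1 - s + s\<^sup>2 / 2"
    by (simp add: exp_minus field_simps)
  then show ?thesis by (simp add: s_def)
qed

text \<open>The penalty \<open>2 * v^2\<close> outweighs the second-order term of the exponential,
  which is at most \<open>9/8 * v^2\<close> for a nonpositive exponent and \<open>v^2\<close>
  otherwise. In the application \<open>u\<close> is \<eta> times the gain and \<open>v\<close> is
  \<eta> times the absolute value of the test; the surplus \<open>- v^2/2\<close> feeds the
  one-round estimate.\<close>

lemma exp_damped_le:
  fixes u v :: real
  assumes "\<bar>u\<bar> \<le> v" "v \<le> 1 / 4"
  shows "exp (u - 2 * v\<^sup>2) \<le> 1 + u - v\<^sup>2 / 2"
proof -
  let ?z = "u - 2 * v\<^sup>2"
  have v: "v \<ge> 0" using assms by simp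
  show ?thesis
  proof (cases "?z \<le> 0")
    case True
    \<comment> \<open>As \<open>v\<close> is at most 1/4, the penalty \<open>2 * v^2\<close> is at
      most \<open>v/2\<close>; hence the factor 3/2 below.\<close>
    have "v * v \<le> v * (1 / 4)" using v assms by (intro mult_left_mono) auto
    then have "\<bar>?z\<bar> \<le> 3 / 2 * v" using assms zero_le_square[of v] unfolding power2_eq_square by linarith
    then have "?z\<^sup>2 \<le> (3 / 2 * v)\<^sup>2" by (meson abs_le_square_iff abs_ge_self order_trans)
    also have "\<dots> = 9 / 4 * v\<^sup>2" by (simp add: power2_eq_square)
    finally show ?thesis using exp_le_quadratic_nonpos[OF True] zero_le_power2[of v] by linarith
  next
    case False
    have "?z \<le> v" using assms zero_le_power2[of v] by linarith
    then have "?z\<^sup>2 \<le> v\<^sup>2" using False by (intro power_mono) auto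
    moreover have "exp ?z \<le> 1 + ?z + ?z\<^sup>2"
      using False \<open>?z \<le> v\<close> assms by (intro exp_bound) auto
    ultimately show ?thesis using zero_le_power2[of v] by linarith
  qed
qed

text \<open>In the reciprocal update the penalty has the opposite sign and adds to the second-order
  term: 17/4 is 2 from the penalty plus 9/4 from the square of 3/2.\<close>

lemma exp_undamped_le:
  fixes u v :: real
  assumes "\<bar>u\<bar> \<le> v" "v \<le> 1 / 4"
  shows "exp (u + 2 * v\<^sup>2) \<le> 1 + u + 17 / 4 * v\<^sup>2"
proof -
  let ?z = "u + 2 * v\<^sup>2"
  have v: "v \<ge> 0" using assms by simp
  have "v * v \<le> v * (1 / 4)" using v assms by (intro mult_left_mono) auto
  then have z: "\<bar>?z\<bar> \<le> 3 / 2 * v" using assms zero_le_square[of v] unfolding power2_eq_square by linarith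
  then have "?z\<^sup>2 \<le> (3 / 2 * v)\<^sup>2" by (meson abs_le_square_iff abs_ge_self order_trans)
  also have "\<dots> = 9 / 4 * v\<^sup>2" by (simp add: power2_eq_square)
  finally have sq: "?z\<^sup>2 \<le> 9 / 4 * v\<^sup>2" .
  have "exp ?z \<le> 1 + ?z + ?z\<^sup>2"
  proof (cases "?z \<le> 0")
    case True
    show ?thesis using exp_le_quadratic_nonpos[OF True] zero_le_power2[of ?z] by linarith
  next
    case False
    then show ?thesis using z assms by (intro exp_bound) linarith+
  qed
  then show ?thesis using sq by linarith
qed

section \<open>The grid and the distributions the algorithm may produce\<close>

lemma finite_grid [simp]: "finite (grid N)"
  by (simp add: grid_def)

lemma grid_nonneg: "p \<in> grid N \<Longrightarrow> 0 \<le> p"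
  by (auto simp: grid_def)

lemma grid_le_one: "p \<in> grid N \<Longrightarrow> p \<le> 1"
  by (auto simp: grid_def divide_le_eq_1)

lemma zero_in_grid: "0 \<in> grid N"
  by (auto simp: grid_def image_iff intro: bexI[of _ 0])

lemma one_in_grid: "N \<ge> 1 \<Longrightarrow> 1 \<in> grid N"
  by (auto simp: grid_def image_iff intro: bexI[of _ N])

lemma set_pmf_admissible_step:
  assumes "admissible_step N F \<psi>" "N \<ge> 1"
  shows "set_pmf \<psi> \<subseteq> grid N"
  using assms zero_in_grid[of N] one_in_grid[of N]
  by (auto simp: admissible_step_def split: if_splits)

text \<open>A point mass gains nothing whatever the label: at 0 the aggregate is nonpositive and
  \<open>y - 0\<close> nonnegative, at 1 both signs are reversed, and at a chosen zero the product
  vanishes. Only a strict sign change is left as a second case.\<close>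

lemma admissible_step_cases:
  assumes "admissible_step N F \<psi>" "y \<in> {0, 1}"
  obtains (point) c where "\<psi> = return_pmf c" "(y - c) * F c \<le> 0"
  | (mix) a b where "b = a + 1 / real N" "F a > 0" "F b < 0"
      "\<psi> = map_pmf (\<lambda>u. if u then b else a) (bernoulli_pmf (F a / (F a - F b)))"
proof (cases "F 0 \<le> 0")
  case True
  then show ?thesis using assms by (intro point[of 0]) (auto simp: admissible_step_def)
next
  case F0: False
  show ?thesis
  proof (cases "F 1 \<ge> 0")
    case True
    then show ?thesis using assms F0 by (intro point[of 1]) (auto simp: admissible_step_def)
  next
    case False
    then obtain a b where ab: "b = a + 1 / real N" "F a \<ge> 0" "0 \<ge> F b"
      "if F a = 0 \<or> F b = 0 then \<exists>c\<in>{a, b}. F c = 0 \<and> \<psi> = return_pmf c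
         else \<psi> = map_pmf (\<lambda>u. if u then b else a) (bernoulli_pmf (F a / (F a - F b)))"
      using assms F0 unfolding admissible_step_def by auto
    show ?thesis
    proof (cases "F a = 0 \<or> F b = 0")
      case True
      then obtain c where "F c = 0" "\<psi> = return_pmf c" using ab by auto
      then show ?thesis by (intro point[of c]) auto
    next
      case False
      then show ?thesis using ab by (intro mix[of b a]) auto
    qed
  qed
qed

text \<open>
  In the mixed case, with \<open>A = F a\<close> and \<open>C = - F b\<close>, the terms linear in \<open>y\<close> cancel and leave
  \<open>\<eta> s / N\<close> for \<open>s = A C / (A + C)\<close>, while the quadratic term is at least \<open>2 \<eta>\<^sup>2 s\<^sup>2\<close>; completing the square
  gives an error of order \<open>1 / N\<^sup>2\<close> instead of \<open>\<eta> / N\<close>.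
\<close>
lemma admissible_step_drift:
  assumes adm: "admissible_step N F \<psi>" and y: "y \<in> {0, 1}" and N: "N \<ge> 1" and \<eta>: "\<eta> > 0"
  shows "(\<Sum>p\<in>grid N. pmf \<psi> p * (\<eta> * (y - p) * F p - \<eta>\<^sup>2 * (F p)\<^sup>2 / 2)) \<le> 1 / (8 * (real N)\<^sup>2)"
proof -
  let ?f = "\<lambda>p. \<eta> * (y - p) * F p - \<eta>\<^sup>2 * (F p)\<^sup>2 / 2"
  have "(\<Sum>p\<in>grid N. pmf \<psi> p * ?f p) = measure_pmf.expectation \<psi> ?f"
    using set_pmf_admissible_step[OF adm N]
    by (subst integral_measure_pmf_real[of "grid N"]) (auto simp: mult.commute)
  also have "\<dots> \<le> 1 / (8 * (real N)\<^sup>2)"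
    using adm y
  proof (cases rule: admissible_step_cases)
    case (point c)
    have "?f c \<le> 0" using point(2) \<eta>
      by (smt (verit) mult.assoc mult_nonneg_nonneg mult_nonneg_nonpos zero_le_divide_iff zero_le_power2)
    then show ?thesis using point(1) by (simp add: order_trans[of _ 0])
  next
    case (mix a b)
    define A C where "A = F a" and "C = - F b"
    define s where "s = A * C / (A + C)"
    have AC: "A > 0" "C > 0" using mix by (auto simp: A_def C_def)
    have l: "0 \<le> A / (A + C)" "A / (A + C) \<le> 1" using AC by auto
    have Fa: "F a = A" and Fb: "F b = - C" by (auto simp: A_def C_def)
    have "measure_pmf.expectation \<psi> ?f = ?f b * (A / (A + C)) + ?f a * (1 - A / (A + C))"
      using l by (simp add: mix(4) Fa Fb)
    also have "1 - A / (A + C) = C / (A + C)" using AC by (simp add: field_simps)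
    also have "?f b * (A / (A + C)) + ?f a * (C / (A + C)) =
        \<eta> * (b - a) * s - \<eta>\<^sup>2 * (A * C) / 2"
    proof -
      have nz: "A + C \<noteq> 0" using AC by simp
      have "?f b * (A / (A + C)) + ?f a * (C / (A + C)) = (?f b * A + ?f a * C) / (A + C)"
        by (simp add: add_divide_distrib)
      also have "?f b * A + ?f a * C = \<eta> * (b - a) * (A * C) - \<eta>\<^sup>2 * (A * C) / 2 * (A + C)"
        unfolding Fa Fb by (simp add: power2_eq_square algebra_simps)
      also have "\<dots> / (A + C) = \<eta> * (b - a) * s - \<eta>\<^sup>2 * (A * C) / 2"
        unfolding diff_divide_distrib nonzero_mult_div_cancel_right[OF nz] s_def by simp
      finally show ?thesis .
    qed
    \<comment> \<open>By the inequality of arithmetic and geometric means,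
      \<open>4 * (A * C)\<close> is at most \<open>(A + C)^2\<close>, so that \<open>4 * s^2\<close>
      is at most \<open>A * C\<close>.\<close>
    also have "\<eta> * (b - a) * s - \<eta>\<^sup>2 * (A * C) / 2 \<le> \<eta> * (1 / N) * s - 2 * \<eta>\<^sup>2 * s\<^sup>2"
    proof -
      have "4 * (A * C) \<le> (A + C)\<^sup>2"
        using zero_le_power2[of "A - C"] by (simp add: power2_eq_square algebra_simps)
      then have "(A * C) * (4 * (A * C)) \<le> (A * C) * (A + C)\<^sup>2"
        using AC by (intro mult_left_mono) auto
      moreover have "4 * s\<^sup>2 = (A * C) * (4 * (A * C)) / (A + C)\<^sup>2"
        by (simp add: s_def power_divide power2_eq_square)
      ultimately have "4 * s\<^sup>2 \<le> A * C" using AC by (simp add: pos_divide_le_eq)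
      then have "\<eta>\<^sup>2 * (4 * s\<^sup>2) \<le> \<eta>\<^sup>2 * (A * C)" by (intro mult_left_mono) auto
      then show ?thesis using mix(1) by simp
    qed
    also have "\<dots> = 1 / (8 * (real N)\<^sup>2) - 2 * (\<eta> * s - 1 / (4 * N))\<^sup>2"
      using N by (simp add: power2_eq_square field_simps)
    also have "\<dots> \<le> 1 / (8 * (real N)\<^sup>2)" by simp
    finally show ?thesis .
  qed
  finally show ?thesis .
qed

section \<open>Growth of the total weight in one round\<close>

text \<open>The variance of \<open>f\<close> under the weights \<open>w\<close> is nonnegative. This
  lets the mean of the squared tests be replaced by the squared aggregate.\<close>

lemma weighted_mean_square_le:
  fixes w f :: "'a \<Rightarrow> real"
  assumes "finite A" "\<And>a. a \<in> A \<Longrightarrow> 0 \<le> w a" "(\<Sum>a\<in>A. w a) = 1"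
  shows "(\<Sum>a\<in>A. w a * f a)\<^sup>2 \<le> (\<Sum>a\<in>A. w a * (f a)\<^sup>2)"
proof -
  let ?F = "\<Sum>a\<in>A. w a * f a"
  have "0 \<le> (\<Sum>a\<in>A. w a * (f a - ?F)\<^sup>2)" using assms by (intro sum_nonneg) auto
  also have "\<dots> = (\<Sum>a\<in>A. w a * (f a)\<^sup>2 - 2 * ?F * (w a * f a) + ?F\<^sup>2 * w a)"
    by (intro sum.cong) (auto simp: power2_eq_square algebra_simps)
  also have "\<dots> = (\<Sum>a\<in>A. w a * (f a)\<^sup>2) - 2 * ?F * ?F + ?F\<^sup>2 * (\<Sum>a\<in>A. w a)"
    by (simp only: sum.distrib sum_subtractf sum_distrib_left)
  finally show ?thesis using assms(3) by (simp add: power2_eq_square)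
qed

lemma weight_pos: "finite G \<Longrightarrow> G \<noteq> {} \<Longrightarrow> 0 < weight G \<eta> h t g"
  by (induction t) (auto simp: split_beta card_gt_0_iff)

lemma weight_cong: "(\<And>s. s < t \<Longrightarrow> h s = h' s) \<Longrightarrow> weight G \<eta> h t g = weight G \<eta> h' t g"
  by (induction t) auto

text \<open>Bounding every update factor by \<open>exp_damped_le\<close> and averaging with the
  normalized weights produces the aggregate in the linear term and, by the variance inequality, its
  square in the quadratic term. What remains is the drift of an admissible step. The label is fixed
  and only the prediction is averaged.\<close>

lemma total_weight_step:
  assumes G: "finite G" "G \<noteq> {}" and bd: "\<And>g p. g \<in> G \<Longrightarrow> p \<in> grid N \<Longrightarrow> \<bar>g (x, p)\<bar> \<le> 1"
    and adm: "admissible_step N (aggregate G \<eta> t h x) \<psi>" and y: "y \<in> {0, 1}" and N: "N \<ge> 1"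
    and \<eta>: "0 < \<eta>" "\<eta> \<le> 1 / 4"
  shows "(\<Sum>p\<in>grid N. pmf \<psi> p * (\<Sum>g\<in>G. weight G \<eta> h t g *
            exp (\<eta> * (y - p) * g (x, p) - 2 * \<eta>\<^sup>2 * (g (x, p))\<^sup>2)))
         \<le> exp (1 / (8 * (real N)\<^sup>2)) * (\<Sum>g\<in>G. weight G \<eta> h t g)"
proof -
  let ?W = "\<Sum>g\<in>G. weight G \<eta> h t g"
  let ?F = "aggregate G \<eta> t h x"
  let ?w = "\<lambda>g. weight G \<eta> h t g / ?W"
  have W: "?W > 0" using G weight_pos[OF G] by (intro sum_pos) auto
  have w0: "?w g \<ge> 0" for g using W weight_pos[OF G, of \<eta> h t g] by simp
  have w1: "(\<Sum>g\<in>G. ?w g) = 1" using W by (simp flip: sum_divide_distrib)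
  have pt: "(\<Sum>g\<in>G. weight G \<eta> h t g * exp (\<eta> * (y - p) * g (x, p) - 2 * \<eta>\<^sup>2 * (g (x, p))\<^sup>2))
      \<le> ?W * (1 + (\<eta> * (y - p) * ?F p - \<eta>\<^sup>2 * (?F p)\<^sup>2 / 2))" if p: "p \<in> grid N" for p
  proof -
    have "exp (\<eta> * (y - p) * g (x, p) - 2 * \<eta>\<^sup>2 * (g (x, p))\<^sup>2)
        \<le> 1 + \<eta> * (y - p) * g (x, p) - \<eta>\<^sup>2 * (g (x, p))\<^sup>2 / 2" if g: "g \<in> G" for g
    proof -
      have "\<bar>y - p\<bar> \<le> 1" using y grid_nonneg[OF p] grid_le_one[OF p] by auto
      then have "\<bar>y - p\<bar> * \<bar>\<eta> * g (x, p)\<bar> \<le> 1 * \<bar>\<eta> * g (x, p)\<bar>" by (intro mult_right_mono) auto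
      then have "\<bar>\<eta> * (y - p) * g (x, p)\<bar> \<le> \<bar>\<eta> * g (x, p)\<bar>" by (simp add: abs_mult mult_ac)
      moreover have "\<eta> * \<bar>g (x, p)\<bar> \<le> 1 / 4 * 1" using bd[OF g p] \<eta> by (intro mult_mono) auto
      then have "\<bar>\<eta> * g (x, p)\<bar> \<le> 1 / 4" using \<eta> by (simp add: abs_mult)
      ultimately have "exp (\<eta> * (y - p) * g (x, p) - 2 * \<bar>\<eta> * g (x, p)\<bar>\<^sup>2)
        \<le> 1 + \<eta> * (y - p) * g (x, p) - \<bar>\<eta> * g (x, p)\<bar>\<^sup>2 / 2" by (rule exp_damped_le)
      then show ?thesis by (simp add: power_mult_distrib mult.assoc)
    qed
    then have "(\<Sum>g\<in>G. weight G \<eta> h t g * exp (\<eta> * (y - p) * g (x, p) - 2 * \<eta>\<^sup>2 * (g (x, p))\<^sup>2))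
      \<le> (\<Sum>g\<in>G. weight G \<eta> h t g * (1 + \<eta> * (y - p) * g (x, p) - \<eta>\<^sup>2 * (g (x, p))\<^sup>2 / 2))"
      using less_imp_le[OF weight_pos[OF G, of \<eta> h t]] by (intro sum_mono mult_left_mono) auto
    \<comment> \<open>Each weight is split into total weight times normalized weight, so that the
      sums over \<open>G\<close> become means.\<close>
    also have "\<dots> = (\<Sum>g\<in>G. ?W * (?w g + \<eta> * (y - p) * (?w g * g (x, p)) - \<eta>\<^sup>2 / 2 * (?w g * (g (x, p))\<^sup>2)))"
    proof (intro sum.cong refl)
      fix g
      define k where "k = ?w g"
      have "weight G \<eta> h t g = ?W * k" using W by (simp add: k_def)
      then have "weight G \<eta> h t g * (1 + \<eta> * (y - p) * g (x, p) - \<eta>\<^sup>2 * (g (x, p))\<^sup>2 / 2) =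
        (?W * k) * (1 + \<eta> * (y - p) * g (x, p) - \<eta>\<^sup>2 * (g (x, p))\<^sup>2 / 2)" by (rule arg_cong)
      also have "\<dots> = ?W * (k + \<eta> * (y - p) * (k * g (x, p)) - \<eta>\<^sup>2 / 2 * (k * (g (x, p))\<^sup>2))"
        by (simp add: algebra_simps)
      finally show "weight G \<eta> h t g * (1 + \<eta> * (y - p) * g (x, p) - \<eta>\<^sup>2 * (g (x, p))\<^sup>2 / 2) =
        ?W * (?w g + \<eta> * (y - p) * (?w g * g (x, p)) - \<eta>\<^sup>2 / 2 * (?w g * (g (x, p))\<^sup>2))"
        unfolding k_def .
    qed
    also have "\<dots> = ?W * ((\<Sum>g\<in>G. ?w g) + \<eta> * (y - p) * ?F p - \<eta>\<^sup>2 / 2 * (\<Sum>g\<in>G. ?w g * (g (x, p))\<^sup>2))"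
      unfolding aggregate_def by (simp only: sum.distrib sum_subtractf flip: sum_distrib_left)
    also have "\<dots> \<le> ?W * ((\<Sum>g\<in>G. ?w g) + \<eta> * (y - p) * ?F p - \<eta>\<^sup>2 / 2 * (?F p)\<^sup>2)"
      unfolding aggregate_def
      using W weighted_mean_square_le[OF G(1), of ?w "\<lambda>g. g (x, p)", OF w0 w1]
      by (intro mult_left_mono diff_left_mono) auto
    finally show ?thesis unfolding w1 by (simp add: algebra_simps)
  qed
  have sum1: "(\<Sum>p\<in>grid N. pmf \<psi> p) = 1"
    using set_pmf_admissible_step[OF adm N] by (intro sum_pmf_eq_1) auto
  have "(\<Sum>p\<in>grid N. pmf \<psi> p * (\<Sum>g\<in>G. weight G \<eta> h t g *
            exp (\<eta> * (y - p) * g (x, p) - 2 * \<eta>\<^sup>2 * (g (x, p))\<^sup>2)))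
      \<le> (\<Sum>p\<in>grid N. pmf \<psi> p * (?W * (1 + (\<eta> * (y - p) * ?F p - \<eta>\<^sup>2 * (?F p)\<^sup>2 / 2))))"
    using pt by (intro sum_mono mult_left_mono) auto
  also have "\<dots> = ?W * ((\<Sum>p\<in>grid N. pmf \<psi> p) +
      (\<Sum>p\<in>grid N. pmf \<psi> p * (\<eta> * (y - p) * ?F p - \<eta>\<^sup>2 * (?F p)\<^sup>2 / 2)))"
    unfolding sum.distrib[symmetric] sum_distrib_left by (intro sum.cong refl) (simp add: algebra_simps)
  also have "\<dots> \<le> ?W * (1 + 1 / (8 * (real N)\<^sup>2))"
    using W admissible_step_drift[OF adm y N \<eta>(1)] unfolding sum1 by (intro mult_left_mono) auto
  also have "\<dots> \<le> ?W * exp (1 / (8 * (real N)\<^sup>2))"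
    using W by (intro mult_left_mono exp_ge_add_one_self) auto
  finally show ?thesis by (simp add: mult.commute)
qed

section \<open>Setting, integrands and basic measurability\<close>

locale approachability =
  fixes X :: "'x measure"
    and D :: "('x \<times> real) measure"
    and G :: "('x \<times> real \<Rightarrow> real) set"
    and \<pi> :: "nat \<Rightarrow> 'x history \<Rightarrow> 'x \<Rightarrow> real pmf"
    and m N :: nat and \<eta> :: real
  assumes N: "N \<ge> 1"
    and D: "prob_space D" and sets_D: "sets D = sets (X \<Otimes>\<^sub>M count_space {0, 1})"
    and G: "finite G" "G \<noteq> {}"
    and G_range: "G \<subseteq> (space X \<times> grid N) \<rightarrow>\<^sub>E {-1..1}"
    and G_measurable: "G \<subseteq> borel_measurable (X \<Otimes>\<^sub>M count_space (grid N))"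
    and \<eta>: "0 < \<eta>" "\<eta> \<le> 1 / 4"
    and alg: "approachability_algorithm X N G \<eta> m \<pi>"
begin

abbreviation "rounds \<equiv> (X \<Otimes>\<^sub>M count_space {0, 1 :: real}) \<Otimes>\<^sub>M count_space (grid N)"
abbreviation "base \<equiv> D \<Otimes>\<^sub>M count_space (grid N)"
abbreviation "hist \<equiv> history_space X N"
abbreviation "pred t h \<equiv> prediction_law N D (\<pi> t h)"

text \<open>\<open>gain\<close> and \<open>energy\<close> play two roles: their integrals under a
  prediction law are bias and mass, and their values at the realized round form the exponent of the
  weight update.\<close>

definition gain :: "('x \<times> real \<Rightarrow> real) \<Rightarrow> ('x \<times> real) \<times> real \<Rightarrow> real" where
  "gain g = (\<lambda>((x, y), p). (y - p) * g (x, p))"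

definition energy :: "('x \<times> real \<Rightarrow> real) \<Rightarrow> ('x \<times> real) \<times> real \<Rightarrow> real" where
  "energy g = (\<lambda>((x, y), p). (g (x, p))\<^sup>2)"

lemma bias_eq: "bias N D g q = (\<integral>e. gain g e \<partial>prediction_law N D q)"
  by (simp add: bias_def gain_def)

lemma mass_eq: "mass N D g q = (\<integral>e. energy g e \<partial>prediction_law N D q)"
  by (simp add: mass_def energy_def)

lemma space_D: "space D = space X \<times> {0, 1}"
  using sets_eq_imp_space_eq[OF sets_D] by (simp add: space_pair_measure)

text \<open>Measurability is proved over \<open>rounds\<close>, which does not mention
  \<open>D\<close>, and carried over to the reference measure \<open>base\<close> by this
  equality.\<close>

lemma sets_base [measurable_cong]: "sets base = sets rounds"
  using sets_D by (intro sets_pair_measure_cong) auto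

lemma space_base: "space base = (space X \<times> {0, 1}) \<times> grid N"
  by (simp add: space_pair_measure space_D)

lemma sets_pred [simp, measurable_cong]: "sets (prediction_law N D q) = sets rounds"
  by (simp add: prediction_law_def sets_base)

lemma space_pred: "space (prediction_law N D q) = (space X \<times> {0, 1}) \<times> grid N"
  using space_base by (simp add: prediction_law_def)

lemma hist_eq: "hist t = PiM {..<t} (\<lambda>_. rounds)"
  by (simp add: history_space_def)

lemma finite_measure_base: "finite_measure base"
proof -
  interpret prob_space D by (rule D)
  interpret C: finite_measure "count_space (grid N)" by (rule finite_measure_count_space) simp
  show ?thesis by (rule finite_measure_pair_measure) unfold_locales
qed

text \<open>Multiplied by \<eta>, these are the hypotheses of the exponential bounds: the gain is
  dominated by the test because label and prediction differ by at most 1.\<close>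

lemma gain_bound:
  assumes "g \<in> G" "e \<in> space base"
  shows "\<bar>gain g e\<bar> \<le> \<bar>g (fst (fst e), snd e)\<bar>" "\<bar>g (fst (fst e), snd e)\<bar> \<le> 1"
proof -
  obtain x y p where e: "e = ((x, y), p)" by (metis surj_pair)
  then have m: "x \<in> space X" "y \<in> {0, 1}" "p \<in> grid N" using assms(2) by (auto simp: space_base)
  then have "\<bar>y - p\<bar> \<le> 1" using grid_nonneg[of p] grid_le_one[of p] by auto
  then have "\<bar>y - p\<bar> * \<bar>g (x, p)\<bar> \<le> 1 * \<bar>g (x, p)\<bar>" by (intro mult_right_mono) auto
  then show "\<bar>gain g e\<bar> \<le> \<bar>g (fst (fst e), snd e)\<bar>" by (simp add: gain_def e abs_mult)
  have "g (x, p) \<in> {-1..1}" using assms(1) G_range m by (auto dest!: PiE_mem subsetD)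
  then show "\<bar>g (fst (fst e), snd e)\<bar> \<le> 1" by (auto simp: e)
qed

lemma energy_eq: "energy g e = \<bar>g (fst (fst e), snd e)\<bar>\<^sup>2"
  by (simp add: energy_def split_beta)

lemma measurable_round_parts [measurable]:
  "(\<lambda>e. snd (fst e)) \<in> borel_measurable rounds" "snd \<in> borel_measurable rounds"
proof -
  have "(\<lambda>p. p) \<in> borel_measurable (count_space A)" for A :: "real set" by simp
  from measurable_compose[OF _ this] show
    "(\<lambda>e. snd (fst e)) \<in> borel_measurable rounds" "snd \<in> borel_measurable rounds"
    using measurable_snd measurable_compose[OF measurable_fst measurable_snd] by blast+
qed

lemma measurable_g [measurable]:
  assumes "g \<in> G"
  shows "(\<lambda>e. g (fst (fst e), snd e)) \<in> borel_measurable rounds"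
proof -
  have [measurable]: "g \<in> borel_measurable (X \<Otimes>\<^sub>M count_space (grid N))" using assms G_measurable by auto
  show ?thesis by measurable
qed

lemma measurable_gain: "g \<in> G \<Longrightarrow> gain g \<in> borel_measurable rounds"
  unfolding gain_def split_beta by measurable

lemma measurable_energy: "g \<in> G \<Longrightarrow> energy g \<in> borel_measurable rounds"
  unfolding energy_def split_beta by measurable

section \<open>Policies and the law of a single round\<close>

text \<open>The algorithm is only assumed measurable in history and context for each fixed grid
  point. Expanding over the finite grid with indicators of the drawn prediction gives joint
  measurability.\<close>

lemma measurable_policy:
  assumes "t < m"
  shows "(\<lambda>(h, e). pmf (\<pi> t h (fst (fst e))) (snd e)) \<in> borel_measurable (hist t \<Otimes>\<^sub>M rounds)"
proof -
  have [measurable]: "(\<lambda>(h, x). pmf (\<pi> t h x) \<gamma>) \<in> borel_measurable (hist t \<Otimes>\<^sub>M X)" if "\<gamma> \<in> grid N" for \<gamma>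
    using alg assms that by (auto simp: approachability_algorithm_def)
  have m: "(\<lambda>(h, e). \<Sum>\<gamma>\<in>grid N. (case (h, fst (fst e)) of (h, x) \<Rightarrow> pmf (\<pi> t h x) \<gamma>) * indicator {\<gamma>} (snd e))
    \<in> borel_measurable (hist t \<Otimes>\<^sub>M rounds)"
    by measurable
  show ?thesis
  proof (rule measurable_cong[THEN iffD1, OF _ m])
    fix w assume "w \<in> space (hist t \<Otimes>\<^sub>M rounds)"
    then have "snd (snd w) \<in> grid N" by (auto simp: space_pair_measure)
    then show "(case w of (h, e) \<Rightarrow> \<Sum>\<gamma>\<in>grid N. (case (h, fst (fst e)) of (h, x) \<Rightarrow> pmf (\<pi> t h x) \<gamma>) * indicator {\<gamma>} (snd e))
        = (case w of (h, e) \<Rightarrow> pmf (\<pi> t h (fst (fst e))) (snd e))"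
      by (simp add: split_beta indicator_def if_distrib cong: if_cong)
  qed
qed

lemma measurable_policy_section [measurable]:
  assumes "t < m" "h \<in> space (hist t)"
  shows "(\<lambda>e. pmf (\<pi> t h (fst (fst e))) (snd e)) \<in> borel_measurable rounds"
  using measurable_Pair2[OF measurable_policy[OF assms(1)] assms(2)] by simp

lemma admissible: "t < m \<Longrightarrow> h \<in> space (hist t) \<Longrightarrow> x \<in> space X \<Longrightarrow>
    admissible_step N (aggregate G \<eta> t h x) (\<pi> t h x)"
  using alg by (auto simp: approachability_algorithm_def)

lemma sum_policy:
  assumes "t < m" "h \<in> space (hist t)" "x \<in> space X"
  shows "(\<Sum>p\<in>grid N. pmf (\<pi> t h x) p) = 1"
  using set_pmf_admissible_step[OF admissible[OF assms] N] by (intro sum_pmf_eq_1) auto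

lemma pred_eq: "prediction_law N D q = density base (\<lambda>e. ennreal (pmf (q (fst (fst e))) (snd e)))"
  unfolding prediction_law_def by (intro arg_cong[where f="density base"] ext) (auto split: prod.split)

lemma nn_integral_pred_base:
  assumes [measurable]: "t < m" "h \<in> space (hist t)" "f \<in> borel_measurable rounds"
  shows "(\<integral>\<^sup>+e. f e \<partial>pred t h) = (\<integral>\<^sup>+e. ennreal (pmf (\<pi> t h (fst (fst e))) (snd e)) * f e \<partial>base)"
  unfolding pred_eq by (rule nn_integral_density) measurable

text \<open>Tonelli with the example outermost: for a fixed example only the prediction is random,
  which is the form in which the one-round weight estimate applies.\<close>

lemma nn_integral_pred:
  assumes [measurable]: "t < m" "h \<in> space (hist t)" "f \<in> borel_measurable rounds"
  shows "(\<integral>\<^sup>+e. f e \<partial>pred t h) = (\<integral>\<^sup>+z. (\<Sum>p\<in>grid N. ennreal (pmf (\<pi> t h (fst z)) p) * f (z, p)) \<partial>D)"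
proof -
  interpret C: finite_measure "count_space (grid N)" by (rule finite_measure_count_space) simp
  have "(\<lambda>e. ennreal (pmf (\<pi> t h (fst (fst e))) (snd e)) * f e) \<in> borel_measurable base"
    by measurable
  from C.nn_integral_fst[OF this] show ?thesis
    unfolding nn_integral_pred_base[OF assms] by (simp add: nn_integral_count_space_finite)
qed

lemma prob_space_pred:
  assumes "t < m" "h \<in> space (hist t)"
  shows "prob_space (pred t h)"
proof
  interpret prob_space D by (rule D)
  have "emeasure (pred t h) (space (pred t h)) = (\<integral>\<^sup>+e. 1 \<partial>pred t h)" by simp
  also have "\<dots> = (\<integral>\<^sup>+z. 1 \<partial>D)"
    using assms unfolding nn_integral_pred[OF assms borel_measurable_const]
    by (intro nn_integral_cong) (auto simp: space_D sum_policy)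
  finally show "emeasure (pred t h) (space (pred t h)) = 1" by (simp add: emeasure_space_1)
qed

lemma measurable_fun_upd_hist: "(\<lambda>(h, e). h(t := e)) \<in> hist t \<Otimes>\<^sub>M rounds \<rightarrow>\<^sub>M hist (Suc t)"
  unfolding hist_eq split_beta by (rule measurable_fun_upd[where J="{..<t}"]) auto

lemma measurable_fun_upd_round:
  "h \<in> space (hist t) \<Longrightarrow> (\<lambda>e. h(t := e)) \<in> rounds \<rightarrow>\<^sub>M hist (Suc t)"
  using measurable_Pair2[OF measurable_fun_upd_hist] by simp

section \<open>The training law as an iterated Markov kernel\<close>

text \<open>This is the function bound in the recursion of \<open>training_law\<close>, named so
  that it can be treated as a Markov kernel.\<close>

definition kernel :: "nat \<Rightarrow> 'x history \<Rightarrow> 'x history measure" where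
  "kernel t h = distr (pred t h) (hist (Suc t)) (\<lambda>e. h(t := e))"

lemma nn_integral_kernel:
  assumes "h \<in> space (hist t)" "f \<in> borel_measurable (hist (Suc t))"
  shows "(\<integral>\<^sup>+h'. f h' \<partial>kernel t h) = (\<integral>\<^sup>+e. f (h(t := e)) \<partial>pred t h)"
  unfolding kernel_def using assms measurable_fun_upd_round[OF assms(1)]
  by (intro nn_integral_distr) (auto cong: measurable_cong_sets)

text \<open>The probability of a set is an integral against the finite measure \<open>base\<close>,
  which does not depend on the history; only the density and the indicator do. Joint measurability
  of the integrand therefore suffices.\<close>

lemma measurable_kernel:
  assumes t: "t < m"
  shows "kernel t \<in> hist t \<rightarrow>\<^sub>M prob_algebra (hist (Suc t))"
proof (intro measurable_prob_algebraI measurable_subprob_algebra)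
  interpret B: finite_measure base by (rule finite_measure_base)
  show P: "prob_space (kernel t h)" if "h \<in> space (hist t)" for h
    unfolding kernel_def using that measurable_fun_upd_round[OF that]
    by (intro prob_space.prob_space_distr prob_space_pred t) (auto cong: measurable_cong_sets)
  then show "subprob_space (kernel t h)" if "h \<in> space (hist t)" for h
    using that by (intro prob_space_imp_subprob_space)
  show "sets (kernel t h) = sets (hist (Suc t))" for h by (simp add: kernel_def)
  fix A assume A [measurable]: "A \<in> sets (hist (Suc t))"
  note measurable_policy[OF t, measurable] measurable_fun_upd_hist[measurable]
  have "(\<lambda>(h, e). ennreal (case (h, e) of (h, e) \<Rightarrow> pmf (\<pi> t h (fst (fst e))) (snd e)) *
      indicator A (case (h, e) of (h, e) \<Rightarrow> h(t := e))) \<in> borel_measurable (hist t \<Otimes>\<^sub>M rounds)"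
    by measurable
  then have "(\<lambda>(h, e). ennreal (pmf (\<pi> t h (fst (fst e))) (snd e)) * indicator A (h(t := e)))
      \<in> borel_measurable (hist t \<Otimes>\<^sub>M base)"
    by (simp add: measurable_cong_sets[OF sets_pair_measure_cong[OF refl sets_base] refl])
  from B.borel_measurable_nn_integral[OF this]
  have "(\<lambda>h. \<integral>\<^sup>+e. ennreal (pmf (\<pi> t h (fst (fst e))) (snd e)) * indicator A (h(t := e)) \<partial>base)
      \<in> borel_measurable (hist t)" .
  also have "?this \<longleftrightarrow> (\<lambda>h. emeasure (kernel t h) A) \<in> borel_measurable (hist t)"
  proof (intro measurable_cong)
    fix h assume h: "h \<in> space (hist t)"
    have ind: "(\<lambda>e. indicator A (h(t := e)) :: ennreal) \<in> borel_measurable rounds"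
      by (rule measurable_compose[OF measurable_fun_upd_round[OF h]]) simp
    have "emeasure (kernel t h) A = (\<integral>\<^sup>+h'. indicator A h' \<partial>kernel t h)"
      by (simp add: kernel_def)
    also have "\<dots> = (\<integral>\<^sup>+e. indicator A (h(t := e)) \<partial>pred t h)"
      using h by (intro nn_integral_kernel) auto
    also have "\<dots> = (\<integral>\<^sup>+e. ennreal (pmf (\<pi> t h (fst (fst e))) (snd e)) * indicator A (h(t := e)) \<partial>base)"
      by (rule nn_integral_pred_base[OF t h ind])
    finally show "(\<integral>\<^sup>+e. ennreal (pmf (\<pi> t h (fst (fst e))) (snd e)) * indicator A (h(t := e)) \<partial>base)
        = emeasure (kernel t h) A" by simp
  qed
  finally show "(\<lambda>h. emeasure (kernel t h) A) \<in> borel_measurable (hist t)" .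
qed

abbreviation "law \<equiv> training_law X N D \<pi>"

lemma law_Suc: "law (Suc t) = law t \<bind> kernel t"
  by (simp add: kernel_def [abs_def])

lemma law_in_prob_algebra: "t \<le> m \<Longrightarrow> law t \<in> space (prob_algebra (hist t))"
proof (induction t)
  case 0
  then show ?case
    by (auto simp: space_prob_algebra hist_eq space_PiM intro!: prob_space_return)
next
  case (Suc t)
  then have "law t \<in> space (prob_algebra (hist t))" "kernel t \<in> hist t \<rightarrow>\<^sub>M prob_algebra (hist (Suc t))"
    using measurable_kernel by auto
  then show ?case
    unfolding law_Suc by (simp add: space_prob_algebra prob_space_bind'[where M="hist t"]
        sets_bind'[where M="hist t"])
qed

text \<open>Tower property: condition on the first \<open>t\<close> rounds and average over round
  \<open>t\<close> first.\<close>

lemma nn_integral_law_Suc: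
  assumes "t < m" "f \<in> borel_measurable (hist (Suc t))"
  shows "(\<integral>\<^sup>+h. f h \<partial>law (Suc t)) = (\<integral>\<^sup>+h. \<integral>\<^sup>+e. f (h(t := e)) \<partial>pred t h \<partial>law t)"
proof -
  have sets: "sets (law t) = sets (hist t)"
    using law_in_prob_algebra[of t] assms by (simp add: space_prob_algebra)
  have "kernel t \<in> law t \<rightarrow>\<^sub>M subprob_algebra (hist (Suc t))"
    using measurable_prob_algebraD[OF measurable_kernel[OF assms(1)]] sets by (simp cong: measurable_cong_sets)
  then have "(\<integral>\<^sup>+h. f h \<partial>law (Suc t)) = (\<integral>\<^sup>+h. \<integral>\<^sup>+h'. f h' \<partial>kernel t h \<partial>law t)"
    unfolding law_Suc by (rule nn_integral_bind[OF assms(2)])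
  also have "\<dots> = (\<integral>\<^sup>+h. \<integral>\<^sup>+e. f (h(t := e)) \<partial>pred t h \<partial>law t)"
    using assms(2) sets_eq_imp_space_eq[OF sets] by (intro nn_integral_cong nn_integral_kernel) auto
  finally show ?thesis .
qed

section \<open>Real integrals under prediction laws and the historical predictor\<close>

text \<open>Here \<open>q\<close> is arbitrary with a measurable density, since both a single round
  and the historical mixture are treated this way.\<close>

lemma integral_pred_base:
  fixes f :: "_ \<Rightarrow> real"
  assumes "(\<lambda>e. pmf (q (fst (fst e))) (snd e)) \<in> borel_measurable rounds"
    and "f \<in> borel_measurable rounds"
  shows "(\<integral>e. f e \<partial>prediction_law N D q) = (\<integral>e. pmf (q (fst (fst e))) (snd e) * f e \<partial>base)"
proof -
  have "(\<lambda>e. pmf (q (fst (fst e))) (snd e)) \<in> borel_measurable base" "f \<in> borel_measurable base"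
    using assms by (simp_all add: measurable_cong_sets[OF sets_base refl])
  then show ?thesis
    unfolding pred_eq by (subst integral_density) auto
qed

text \<open>Conditional biases and masses have to be random variables of the history before the
  drift can be integrated. As for the kernel, the history enters only through a density with respect
  to \<open>base\<close>.\<close>

lemma measurable_integral_pred:
  fixes f :: "_ \<Rightarrow> real"
  assumes t: "t < m" and f: "f \<in> borel_measurable rounds"
  shows "(\<lambda>h. \<integral>e. f e \<partial>pred t h) \<in> borel_measurable (hist t)"
proof -
  interpret B: finite_measure base by (rule finite_measure_base)
  note measurable_policy[OF t, measurable] f[measurable]
  have "(\<lambda>(h, e). (case (h, e) of (h, e) \<Rightarrow> pmf (\<pi> t h (fst (fst e))) (snd e)) * f e)
      \<in> borel_measurable (hist t \<Otimes>\<^sub>M rounds)"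
    by measurable
  then have "(\<lambda>(h, e). pmf (\<pi> t h (fst (fst e))) (snd e) * f e) \<in> borel_measurable (hist t \<Otimes>\<^sub>M base)"
    by (simp add: measurable_cong_sets[OF sets_pair_measure_cong[OF refl sets_base] refl])
  from B.borel_measurable_lebesgue_integral[OF this] show ?thesis
    by (rule measurable_cong[THEN iffD1, rotated])
      (simp add: integral_pred_base measurable_policy_section t f)
qed

lemma measurable_restrict_hist: "s \<le> t \<Longrightarrow> (\<lambda>h. restrict h {..<s}) \<in> hist t \<rightarrow>\<^sub>M hist s"
  unfolding hist_eq by (rule measurable_restrict_subset) auto

lemma restrict_in_hist: "s \<le> t \<Longrightarrow> h \<in> space (hist t) \<Longrightarrow> restrict h {..<s} \<in> space (hist s)"
  using measurable_space[OF measurable_restrict_hist] .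

lemma restrict_hist_self: "h \<in> space (hist t) \<Longrightarrow> restrict h {..<t} = h"
  by (auto simp: hist_eq space_PiM PiE_restrict)

lemma integrable_base:
  fixes f :: "_ \<Rightarrow> real"
  assumes "f \<in> borel_measurable rounds" "\<And>e. e \<in> space base \<Longrightarrow> \<bar>f e\<bar> \<le> 1"
  shows "integrable base f"
proof -
  interpret B: finite_measure base by (rule finite_measure_base)
  show ?thesis
    by (intro B.integrable_const_bound[of _ 1] AE_I2)
      (use assms in \<open>auto simp: measurable_cong_sets[OF sets_base refl]\<close>)
qed

lemma integrable_pred:
  fixes f :: "_ \<Rightarrow> real"
  assumes "t < m" "h \<in> space (hist t)" "f \<in> borel_measurable rounds"
    and "\<And>e. e \<in> space base \<Longrightarrow> \<bar>f e\<bar> \<le> 1"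
  shows "integrable (pred t h) f"
proof -
  interpret prob_space "pred t h" using assms by (intro prob_space_pred)
  show ?thesis
    by (intro integrable_const_bound[of _ 1] AE_I2)
      (use assms in \<open>auto simp: space_pred space_base cong: measurable_cong_sets\<close>)
qed

lemma gain_le_1: "g \<in> G \<Longrightarrow> e \<in> space base \<Longrightarrow> \<bar>gain g e\<bar> \<le> 1"
  using gain_bound[of g e] by linarith

lemma energy_le_1: "g \<in> G \<Longrightarrow> e \<in> space base \<Longrightarrow> \<bar>energy g e\<bar> \<le> 1"
  using gain_bound(2)[of g e] by (simp add: energy_eq abs_square_le_1)

text \<open>The density of the mixture is the average of the \<open>m\<close> round densities, and
  boundedness of \<open>f\<close> allows integrating term by term. The truncations of
  \<open>h\<close> are the histories that the individual rounds saw.\<close>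

lemma integral_historical_predictor:
  fixes f :: "_ \<Rightarrow> real"
  assumes m: "m \<ge> 1" and h: "h \<in> space (hist m)" and f: "f \<in> borel_measurable rounds"
    and bd: "\<And>e. e \<in> space base \<Longrightarrow> \<bar>f e\<bar> \<le> 1"
  shows "(\<integral>e. f e \<partial>prediction_law N D (historical_predictor m \<pi> h)) =
    (\<Sum>j<m. \<integral>e. f e \<partial>pred j (restrict h {..<j})) / real m"
proof -
  let ?r = "\<lambda>j e. pmf (\<pi> j (restrict h {..<j}) (fst (fst e))) (snd e)"
  \<comment> \<open>The uniform distribution over rounds is meaningful only on a nonempty index
    set.\<close>
  have nonempty: "{..<m} \<noteq> {}" using m by (auto simp: lessThan_empty_iff)
  have pmf: "pmf (historical_predictor m \<pi> h (fst (fst e))) (snd e) = (\<Sum>j<m. ?r j e) / real m" for e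
    using nonempty by (simp add: historical_predictor_def pmf_bind integral_pmf_of_set)
  have r [measurable]: "?r j \<in> borel_measurable rounds" if "j < m" for j
    using measurable_policy_section[OF that restrict_in_hist[OF _ h]] that by simp
  note f [measurable]
  have int: "integrable base (\<lambda>e. ?r j e * f e)" if "j < m" for j
  proof (rule integrable_base)
    show "(\<lambda>e. ?r j e * f e) \<in> borel_measurable rounds" using that by measurable
    show "\<bar>?r j e * f e\<bar> \<le> 1" if "e \<in> space base" for e
      using bd[OF that] by (simp add: abs_mult mult_le_one pmf_le_1)
  qed
  have "(\<integral>e. f e \<partial>prediction_law N D (historical_predictor m \<pi> h)) =
      (\<integral>e. (\<Sum>j<m. ?r j e * f e) / real m \<partial>base)"
    by (subst integral_pred_base) (auto simp: pmf sum_distrib_right f intro!: borel_measurable_sum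
        borel_measurable_divide r)
  also have "\<dots> = (\<Sum>j<m. \<integral>e. ?r j e * f e \<partial>base) / real m"
    using int by (simp add: Bochner_Integration.integral_sum)
  also have "\<dots> = (\<Sum>j<m. \<integral>e. f e \<partial>pred j (restrict h {..<j})) / real m"
    using r f by (intro arg_cong2[where f="(/)"] sum.cong refl) (simp add: integral_pred_base)
  finally show ?thesis .
qed

section \<open>The potential and its supermartingale property\<close>

text \<open>The summands are conditional means given the past, not realized gains, so the drift
  after \<open>t\<close> rounds is already determined by the first \<open>t - 1\<close> of them. It
  accumulates the exponents that compensate the reciprocal weight.\<close>

definition drift :: "nat \<Rightarrow> 'x history \<Rightarrow> ('x \<times> real \<Rightarrow> real) \<Rightarrow> real" where
  "drift t h g = (\<Sum>s<t. \<eta> * bias N D g (\<pi> s (restrict h {..<s}))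
     - 5 * \<eta>\<^sup>2 * mass N D g (\<pi> s (restrict h {..<s})))"

text \<open>Both parts start at 1: the initial weights sum to 1, and their reciprocals sum to the
  square of \<open>card G\<close>. Adding them lets a single application of Markov's inequality
  control the total weight and all tests at once.\<close>

definition potential :: "nat \<Rightarrow> 'x history \<Rightarrow> real" where
  "potential t h = exp (- (real t / (8 * (real N)\<^sup>2))) * (\<Sum>g\<in>G. weight G \<eta> h t g)
     + (\<Sum>g\<in>G. exp (drift t h g) / weight G \<eta> h t g) / (real (card G))\<^sup>2"

lemma weight_Suc: "weight G \<eta> h (Suc t) g =
    weight G \<eta> h t g * exp (\<eta> * gain g (h t) - 2 * \<eta>\<^sup>2 * energy g (h t))"
  by (simp add: gain_def energy_def split_beta mult.assoc)

lemma measurable_weight: "g \<in> G \<Longrightarrow> s \<le> t \<Longrightarrow> (\<lambda>h. weight G \<eta> h s g) \<in> borel_measurable (hist t)"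
proof (induction s)
  case (Suc s)
  have [measurable]: "(\<lambda>h. h s) \<in> hist t \<rightarrow>\<^sub>M rounds"
    unfolding hist_eq using Suc.prems by (intro measurable_component_singleton) auto
  note measurable_gain[OF \<open>g \<in> G\<close>, measurable] measurable_energy[OF \<open>g \<in> G\<close>, measurable]
  have [measurable]: "(\<lambda>h. weight G \<eta> h s g) \<in> borel_measurable (hist t)" using Suc by simp
  show ?case unfolding weight_Suc by measurable
qed simp

lemma measurable_bias_restrict:
  assumes "g \<in> G" "s < m" "s \<le> t"
  shows "(\<lambda>h. bias N D g (\<pi> s (restrict h {..<s}))) \<in> borel_measurable (hist t)"
    and "(\<lambda>h. mass N D g (\<pi> s (restrict h {..<s}))) \<in> borel_measurable (hist t)"
  using assms unfolding bias_eq mass_eq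
  by (auto intro!: measurable_compose[OF measurable_restrict_hist measurable_integral_pred]
      measurable_gain measurable_energy)

lemma measurable_drift:
  "t \<le> m \<Longrightarrow> g \<in> G \<Longrightarrow> (\<lambda>h. drift t h g) \<in> borel_measurable (hist t)"
  unfolding drift_def
  by (intro borel_measurable_sum borel_measurable_diff borel_measurable_times
      borel_measurable_const measurable_bias_restrict) auto

lemma measurable_potential:
  assumes "t \<le> m"
  shows "potential t \<in> borel_measurable (hist t)"
  unfolding potential_def [abs_def] using measurable_drift[OF assms]
  by (intro borel_measurable_add borel_measurable_times borel_measurable_const borel_measurable_sum
      borel_measurable_divide measurable_weight borel_measurable_exp[THEN measurable_compose[rotated]])
    auto

text \<open>The bound of \<open>total_weight_step\<close> holds for every example, so it survives
  integration over \<open>D\<close>.\<close>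

lemma total_weight_expectation:
  assumes t: "t < m" and h: "h \<in> space (hist t)"
  shows "(\<integral>\<^sup>+e. ennreal (\<Sum>g\<in>G. weight G \<eta> h t g * exp (\<eta> * gain g e - 2 * \<eta>\<^sup>2 * energy g e)) \<partial>pred t h)
    \<le> ennreal (exp (1 / (8 * (real N)\<^sup>2)) * (\<Sum>g\<in>G. weight G \<eta> h t g))"
proof -
  let ?f = "\<lambda>e. \<Sum>g\<in>G. weight G \<eta> h t g * exp (\<eta> * gain g e - 2 * \<eta>\<^sup>2 * energy g e)"
  let ?c = "exp (1 / (8 * (real N)\<^sup>2)) * (\<Sum>g\<in>G. weight G \<eta> h t g)"
  note [measurable] = measurable_gain measurable_energy
  have "(\<integral>\<^sup>+e. ennreal (?f e) \<partial>pred t h) =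
      (\<integral>\<^sup>+z. (\<Sum>p\<in>grid N. ennreal (pmf (\<pi> t h (fst z)) p) * ennreal (?f (z, p))) \<partial>D)"
    by (rule nn_integral_pred[OF t h]) measurable
  also have "\<dots> \<le> (\<integral>\<^sup>+z. ennreal ?c \<partial>D)"
  proof (rule nn_integral_mono)
    fix z assume "z \<in> space D"
    then obtain x y where z: "z = (x, y)" "x \<in> space X" "y \<in> {0, 1}" by (auto simp: space_D)
    have f0: "0 \<le> ?f e" for e using weight_pos[OF G] by (intro sum_nonneg) (auto intro: less_imp_le)
    have "(\<Sum>p\<in>grid N. pmf (\<pi> t h x) p * ?f (z, p)) \<le> ?c"
      unfolding z(1) gain_def energy_def split_beta fst_conv snd_conv mult.assoc[symmetric]
    proof (rule total_weight_step[OF G _ admissible[OF t h z(2)] z(3) N \<eta>])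
      fix g p assume "g \<in> G" "p \<in> grid N"
      then show "\<bar>g (x, p)\<bar> \<le> 1" using gain_bound(2)[of g "((x, y), p)"] z by (simp add: space_base)
    qed
    then show "(\<Sum>p\<in>grid N. ennreal (pmf (\<pi> t h (fst z)) p) * ennreal (?f (z, p))) \<le> ennreal ?c"
      using f0 by (simp add: z(1) sum_nonneg sum_ennreal ennreal_mult'[symmetric] ennreal_leI)
  qed
  also have "\<dots> = ennreal ?c" using prob_space.emeasure_space_1[OF D] by simp
  finally show ?thesis .
qed

text \<open>The left side averages the reciprocal of the update factor. Integrating the quadratic
  bound of \<open>exp_undamped_le\<close> turns gain and energy into bias and mass, and
  \<open>1 + x \<le> exp x\<close> restores the exponential form.\<close>

lemma inverse_update_expectation:
  assumes t: "t < m" and h: "h \<in> space (hist t)" and g: "g \<in> G"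
  shows "(\<integral>\<^sup>+e. ennreal (exp (- (\<eta> * gain g e - 2 * \<eta>\<^sup>2 * energy g e))) \<partial>pred t h)
    \<le> ennreal (exp (- (\<eta> * bias N D g (\<pi> t h) - 5 * \<eta>\<^sup>2 * mass N D g (\<pi> t h))))"
proof -
  interpret prob_space "pred t h" using t h by (rule prob_space_pred)
  have ig: "integrable (pred t h) (gain g)"
    using integrable_pred[OF t h measurable_gain[OF g] gain_le_1[OF g]] .
  have ie: "integrable (pred t h) (energy g)"
    using integrable_pred[OF t h measurable_energy[OF g] energy_le_1[OF g]] .
  let ?q = "\<lambda>e. 1 - \<eta> * gain g e + 17 / 4 * (\<eta>\<^sup>2 * energy g e)"
  have pt: "exp (- (\<eta> * gain g e - 2 * \<eta>\<^sup>2 * energy g e)) \<le> ?q e" if "e \<in> space (pred t h)" for e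
  proof -
    have e: "e \<in> space base" using that by (simp add: space_pred space_base)
    let ?v = "\<eta> * \<bar>g (fst (fst e), snd e)\<bar>"
    have "\<bar>- (\<eta> * gain g e)\<bar> \<le> ?v" "?v \<le> 1 / 4"
      using gain_bound[OF g e] \<eta> mult_mono[of \<eta> "1/4" "\<bar>g (fst (fst e), snd e)\<bar>" 1]
      by (auto simp: abs_mult)
    from exp_undamped_le[OF this] show ?thesis
      by (simp add: energy_eq power_mult_distrib mult.assoc)
  qed
  have "(\<integral>\<^sup>+e. ennreal (exp (- (\<eta> * gain g e - 2 * \<eta>\<^sup>2 * energy g e))) \<partial>pred t h)
      \<le> (\<integral>\<^sup>+e. ennreal (?q e) \<partial>pred t h)"
    using pt by (intro nn_integral_mono ennreal_leI)
  also have "\<dots> = ennreal (\<integral>e. ?q e \<partial>pred t h)"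
  proof (rule nn_integral_eq_integral)
    show "integrable (pred t h) ?q" using ig ie by simp
    show "AE e in pred t h. 0 \<le> ?q e"
      using pt by (intro AE_I2) (meson exp_ge_zero order_trans)
  qed
  also have "(\<integral>e. ?q e \<partial>pred t h) = 1 - \<eta> * bias N D g (\<pi> t h) + 17 / 4 * (\<eta>\<^sup>2 * mass N D g (\<pi> t h))"
    using ig ie by (simp add: bias_eq mass_eq prob_space)
  \<comment> \<open>As the mass is nonnegative, 17/4 may be rounded up to 5; this is the constant in
    front of the mass in the theorem.\<close>
  also have "\<dots> \<le> 1 + - (\<eta> * bias N D g (\<pi> t h) - 5 * \<eta>\<^sup>2 * mass N D g (\<pi> t h))"
  proof -
    have "0 \<le> mass N D g (\<pi> t h)" unfolding mass_eq by (intro Bochner_Integration.integral_nonneg) (simp add: energy_eq)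
    then have "0 \<le> \<eta>\<^sup>2 * mass N D g (\<pi> t h)" by simp
    then show ?thesis by simp
  qed
  also have "\<dots> \<le> exp (- (\<eta> * bias N D g (\<pi> t h) - 5 * \<eta>\<^sup>2 * mass N D g (\<pi> t h)))"
    by (rule exp_ge_add_one_self)
  finally show ?thesis by (simp add: ennreal_leI)
qed

text \<open>The policies of rounds up to \<open>t\<close> do not see the entry \<open>e\<close>, so
  the increment is known before round \<open>t\<close> is drawn.\<close>

lemma drift_upd:
  assumes "h \<in> space (hist t)"
  shows "drift (Suc t) (h(t := e)) g =
    drift t h g + (\<eta> * bias N D g (\<pi> t h) - 5 * \<eta>\<^sup>2 * mass N D g (\<pi> t h))"
proof -
  have "restrict (h(t := e)) {..<s} = restrict h {..<s}" if "s \<le> t" for s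
    using that by (auto simp: restrict_def)
  then show ?thesis using restrict_hist_self[OF assms] by (simp add: drift_def)
qed

text \<open>The expected growth of the total weight is cancelled by the additional factor
  \<open>exp (- 1 / (8 * N^2))\<close>, and the expected reciprocal update by the exponential of the
  drift increment, which is constant in \<open>e\<close> and leaves the integral.\<close>

lemma potential_step:
  assumes t: "t < m" and h: "h \<in> space (hist t)"
  shows "(\<integral>\<^sup>+e. ennreal (potential (Suc t) (h(t := e))) \<partial>pred t h) \<le> ennreal (potential t h)"
proof -
  note [measurable] = measurable_gain measurable_energy
  let ?N = "1 / (8 * (real N)\<^sup>2)"
  let ?w = "\<lambda>g. weight G \<eta> h t g"
  let ?z = "\<lambda>g e. \<eta> * gain g e - 2 * \<eta>\<^sup>2 * energy g e"
  let ?b = "\<lambda>g. \<eta> * bias N D g (\<pi> t h) - 5 * \<eta>\<^sup>2 * mass N D g (\<pi> t h)"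
  define c where "c = exp (- (real (Suc t) / (8 * (real N)\<^sup>2)))"
  \<comment> \<open>The part of each reciprocal summand that does not depend on the new
    round.\<close>
  define d where "d g = exp (drift t h g + ?b g) / ?w g / (real (card G))\<^sup>2" for g
  have w: "?w g > 0" for g by (rule weight_pos[OF G])
  have d0: "d g \<ge> 0" for g using w[of g] by (simp add: d_def)
  have c0: "c \<ge> 0" by (simp add: c_def)
  have S0: "0 \<le> (\<Sum>g\<in>G. ?w g * exp (?z g e))" for e
    using w by (intro sum_nonneg) (auto intro: less_imp_le)
  have upd: "weight G \<eta> (h(t := e)) t g = ?w g" for e g by (rule weight_cong) auto
  have pot: "potential (Suc t) (h(t := e)) =
      c * (\<Sum>g\<in>G. ?w g * exp (?z g e)) + (\<Sum>g\<in>G. d g * exp (- ?z g e))" for e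
  proof -
    have "a / (w * exp z) / k = a / w / k * exp (- z)" for a w z k :: real
      by (simp add: exp_minus divide_inverse mult_ac)
    then show ?thesis
      unfolding potential_def weight_Suc upd drift_upd[OF h] c_def d_def fun_upd_same sum_divide_distrib
      by simp
  qed
  have "(\<integral>\<^sup>+e. ennreal (potential (Suc t) (h(t := e))) \<partial>pred t h) =
      (\<integral>\<^sup>+e. ennreal c * ennreal (\<Sum>g\<in>G. ?w g * exp (?z g e)) +
        (\<Sum>g\<in>G. ennreal (d g) * ennreal (exp (- ?z g e))) \<partial>pred t h)"
    unfolding pot using c0 d0 S0
    by (intro nn_integral_cong) (simp add: ennreal_plus sum_nonneg ennreal_mult sum_ennreal[symmetric] del: sum_ennreal)
  also have "\<dots> = ennreal c * (\<integral>\<^sup>+e. ennreal (\<Sum>g\<in>G. ?w g * exp (?z g e)) \<partial>pred t h) +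
        (\<Sum>g\<in>G. ennreal (d g) * (\<integral>\<^sup>+e. ennreal (exp (- ?z g e)) \<partial>pred t h))"
    by (simp add: nn_integral_add nn_integral_sum nn_integral_cmult)
  also have "\<dots> \<le> ennreal c * ennreal (exp ?N * (\<Sum>g\<in>G. ?w g)) +
        (\<Sum>g\<in>G. ennreal (d g) * ennreal (exp (- ?b g)))"
    by (intro add_mono mult_left_mono sum_mono total_weight_expectation inverse_update_expectation t h) auto
  also have "\<dots> = ennreal (c * (exp ?N * (\<Sum>g\<in>G. ?w g)) + (\<Sum>g\<in>G. d g * exp (- ?b g)))"
    using c0 d0 w by (simp add: ennreal_plus sum_nonneg ennreal_mult less_imp_le sum_ennreal[symmetric] del: sum_ennreal)
  also have "c * (exp ?N * (\<Sum>g\<in>G. ?w g)) = exp (- (real t / (8 * (real N)\<^sup>2))) * (\<Sum>g\<in>G. ?w g)"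
  proof -
    have "c * exp ?N = exp (- (real t / (8 * (real N)\<^sup>2)))"
      unfolding c_def exp_add[symmetric] by (simp add: add_divide_distrib)
    then show ?thesis by (simp add: mult.assoc[symmetric])
  qed
  also have "(\<Sum>g\<in>G. d g * exp (- ?b g)) = (\<Sum>g\<in>G. exp (drift t h g) / ?w g) / (real (card G))\<^sup>2"
  proof -
    have "d g * exp (- ?b g) = exp (drift t h g) / ?w g / (real (card G))\<^sup>2" for g
    proof -
      have "exp (drift t h g + ?b g) * exp (- ?b g) = exp (drift t h g)"
        unfolding exp_add[symmetric] by simp
      then show ?thesis unfolding d_def times_divide_eq_left by (rule arg_cong)
    qed
    then show ?thesis by (simp add: sum_divide_distrib)
  qed
  finally show ?thesis unfolding potential_def[of t h] .
qed

lemma sets_law: "t \<le> m \<Longrightarrow> sets (law t) = sets (hist t)"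
  using law_in_prob_algebra[of t] by (simp add: space_prob_algebra)

lemma prob_space_law: "t \<le> m \<Longrightarrow> prob_space (law t)"
  using law_in_prob_algebra[of t] by (simp add: space_prob_algebra)

lemma space_law: "t \<le> m \<Longrightarrow> space (law t) = space (hist t)"
  by (rule sets_eq_imp_space_eq[OF sets_law])

text \<open>The supermartingale inequality is iterated through the tower property from the
  deterministic initial value 2.\<close>

lemma expected_potential_le: "t \<le> m \<Longrightarrow> (\<integral>\<^sup>+h. ennreal (potential t h) \<partial>law t) \<le> 2"
proof (induction t)
  case 0
  have card: "real (card G) > 0" using G by (simp add: card_gt_0_iff)
  have "potential 0 h = 2" for h
    using card by (simp add: potential_def drift_def power2_eq_square)
  then show ?case using prob_space.emeasure_space_1[OF prob_space_law[of 0]] by simp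
next
  case (Suc t)
  then have t: "t < m" by simp
  have "(\<integral>\<^sup>+h. ennreal (potential (Suc t) h) \<partial>law (Suc t)) =
      (\<integral>\<^sup>+h. \<integral>\<^sup>+e. ennreal (potential (Suc t) (h(t := e))) \<partial>pred t h \<partial>law t)"
    using measurable_potential[OF Suc.prems] by (intro nn_integral_law_Suc[OF t]) measurable
  also have "\<dots> \<le> (\<integral>\<^sup>+h. ennreal (potential t h) \<partial>law t)"
    using t by (intro nn_integral_mono potential_step) (auto simp: space_law)
  also have "\<dots> \<le> 2" using Suc by simp
  finally show ?case .
qed

section \<open>From the potential to the high-probability bound\<close>

text \<open>Both parts of the potential are nonnegative, so each is at most
  \<open>2 / \<delta>\<close>. The first bounds the weight of \<open>g\<close> from above, the
  second bounds \<open>exp (drift m h g)\<close> by a multiple of that weight. Chaining them removes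
  the weight; the two factors \<open>2 / \<delta>\<close> and the square of \<open>card G\<close>
  give the coefficient 2 of the logarithm.\<close>

lemma drift_le:
  assumes g: "g \<in> G" and \<delta>: "\<delta> > 0" and pot: "potential m h \<le> 2 / \<delta>"
  shows "drift m h g \<le> 2 * ln (2 * real (card G) / \<delta>) + real m / (8 * (real N)\<^sup>2)"
proof -
  let ?w = "\<lambda>g. weight G \<eta> h m g"
  let ?N = "real m / (8 * (real N)\<^sup>2)"
  have w: "?w g > 0" for g by (rule weight_pos[OF G])
  have card: "real (card G) > 0" using G by (simp add: card_gt_0_iff)
  have "?w g \<le> (\<Sum>g\<in>G. ?w g)" by (rule member_le_sum[OF g]) (auto intro: less_imp_le w G)
  moreover have "exp (- ?N) * (\<Sum>g\<in>G. ?w g) \<le> 2 / \<delta>"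
    using pot w unfolding potential_def by (smt (verit) divide_nonneg_nonneg exp_ge_zero sum_nonneg zero_le_power2)
  ultimately have "exp (- ?N) * ?w g \<le> 2 / \<delta>"
    by (meson exp_ge_zero mult_left_mono order_trans)
  then have wg: "?w g \<le> 2 / \<delta> * exp ?N" by (simp add: exp_minus field_simps)
  have "exp (drift m h g) / ?w g \<le> (\<Sum>g\<in>G. exp (drift m h g) / ?w g)"
    by (rule member_le_sum[OF g]) (auto intro: less_imp_le w G divide_nonneg_pos)
  moreover have "(\<Sum>g\<in>G. exp (drift m h g) / ?w g) / (real (card G))\<^sup>2 \<le> 2 / \<delta>"
    using pot w unfolding potential_def by (smt (verit) mult_nonneg_nonneg exp_ge_zero sum_nonneg)
  then have "(\<Sum>g\<in>G. exp (drift m h g) / ?w g) \<le> 2 / \<delta> * (real (card G))\<^sup>2"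
    using card by (subst (asm) pos_divide_le_eq) auto
  ultimately have "exp (drift m h g) / ?w g \<le> 2 / \<delta> * (real (card G))\<^sup>2" by linarith
  then have "exp (drift m h g) \<le> 2 / \<delta> * (real (card G))\<^sup>2 * ?w g"
    using w[of g] by (simp add: pos_divide_le_eq)
  also have "\<dots> \<le> 2 / \<delta> * (real (card G))\<^sup>2 * (2 / \<delta> * exp ?N)"
    using wg \<delta> by (intro mult_left_mono) auto
  also have "\<dots> = (2 * real (card G) / \<delta>)\<^sup>2 * exp ?N" by (simp add: power2_eq_square)
  also have "\<dots> = exp (2 * ln (2 * real (card G) / \<delta>) + ?N)"
    using card \<delta> by (simp add: exp_add exp_double)
  finally show ?thesis by simp
qed

text \<open>The drift sums population quantities of exactly the policies that the historical
  predictor mixes uniformly. Training and test quantities thus agree up to scaling, with no separate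
  generalization step.\<close>

lemma drift_historical_predictor:
  assumes m: "m \<ge> 1" and h: "h \<in> space (hist m)" and g: "g \<in> G"
  shows "drift m h g = \<eta> * real m * (bias N D g (historical_predictor m \<pi> h)
    - 5 * \<eta> * mass N D g (historical_predictor m \<pi> h))"
proof -
  note integral_historical_predictor[OF m h measurable_gain[OF g] gain_le_1[OF g]]
    integral_historical_predictor[OF m h measurable_energy[OF g] energy_le_1[OF g]]
  then show ?thesis using m
    unfolding drift_def bias_eq mass_eq
    by (simp add: sum_subtractf sum_distrib_left[symmetric] power2_eq_square right_diff_distrib)
qed

text \<open>Markov's inequality for the potential, whose mean is at most 2, at threshold
  \<open>2 / \<delta>\<close>; off the bad event \<open>drift_le\<close> holds for every test
  simultaneously, so no further union bound over \<open>G\<close> is taken.\<close>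

lemma high_probability_bound:
  assumes m: "m \<ge> 1" and \<delta>: "\<delta> > 0"
    and R: "2 * ln (2 * real (card G) / \<delta>) + real m / (8 * (real N)\<^sup>2) \<le> R"
  shows "measure (law m)
      {h \<in> space (law m). \<forall>g\<in>G.
         bias N D g (historical_predictor m \<pi> h)
           \<le> 5 * \<eta> * mass N D g (historical_predictor m \<pi> h)
             + R / (\<eta> * real m)}
      \<ge> 1 - \<delta>" (is "measure _ ?E \<ge> _")
proof -
  interpret prob_space "law m" by (rule prob_space_law) simp
  have sp: "space (law m) = space (hist m)" and st: "sets (law m) = sets (hist m)"
    by (simp_all add: space_law sets_law)
  have pos: "\<eta> * real m > 0" using m \<eta> by simp
  \<comment> \<open>Multiplying by the positive number \<open>\<eta> * m\<close> turns the event
    into one about the drift, whose measurability is known.\<close>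
  have E: "?E = {h \<in> space (hist m). \<forall>g\<in>G. drift m h g \<le> R}"
  proof -
    have "bias N D g (historical_predictor m \<pi> h)
        \<le> 5 * \<eta> * mass N D g (historical_predictor m \<pi> h) + R / (\<eta> * real m)
      \<longleftrightarrow> drift m h g \<le> R" if "h \<in> space (hist m)" "g \<in> G" for h g
    proof -
      let ?d = "bias N D g (historical_predictor m \<pi> h) - 5 * \<eta> * mass N D g (historical_predictor m \<pi> h)"
      have "?d \<le> R / (\<eta> * real m) \<longleftrightarrow> drift m h g \<le> R"
        unfolding drift_historical_predictor[OF m that] pos_le_divide_eq[OF pos] by (simp only: mult.commute)
      then show ?thesis by linarith
    qed
    then show ?thesis unfolding sp by blast
  qed
  \<comment> \<open>The event that the potential is at least \<open>2 / \<delta>\<close>, written in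
    the form that Markov's inequality for nonnegative integrals takes.\<close>
  let ?bad = "{h \<in> space (hist m). 1 \<le> ennreal (\<delta> / 2) * ennreal (potential m h)}"
  note measurable_potential[of m, measurable] measurable_drift[of m, measurable]
  have E_sets: "?E \<in> sets (law m)" unfolding E st using G by measurable
  have bad_sets: "?bad \<in> sets (law m)" unfolding st by measurable
  have "emeasure (law m) ?bad \<le> ennreal (\<delta> / 2) * (\<integral>\<^sup>+h. ennreal (potential m h) * indicator (space (hist m)) h \<partial>law m)"
    using st by (intro nn_integral_Markov_inequality) (auto cong: measurable_cong_sets)
  also have "\<dots> = ennreal (\<delta> / 2) * (\<integral>\<^sup>+h. ennreal (potential m h) \<partial>law m)"
    by (intro arg_cong2[where f="(*)"] nn_integral_cong refl) (simp add: sp)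
  also have "\<dots> \<le> ennreal (\<delta> / 2) * 2"
    by (intro mult_left_mono expected_potential_le) auto
  also have "\<dots> = ennreal \<delta>" using \<delta> by (simp flip: ennreal_numeral ennreal_mult)
  finally have "prob ?bad \<le> \<delta>" using \<delta> by (simp add: emeasure_eq_measure)
  then have "1 - \<delta> \<le> prob (space (law m) - ?bad)" using prob_compl[OF bad_sets] by simp
  also have "\<dots> \<le> prob ?E"
  proof (rule finite_measure_mono[OF _ E_sets])
    show "space (law m) - ?bad \<subseteq> ?E" unfolding E
    proof
      fix h assume "h \<in> space (law m) - ?bad"
      then have h: "h \<in> space (hist m)" and "ennreal (\<delta> / 2) * ennreal (potential m h) < 1"
        by (auto simp: sp not_le)
      then have "ennreal (\<delta> / 2 * potential m h) < 1" using \<delta> by (subst ennreal_mult') auto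
      then have "potential m h \<le> 2 / \<delta>" using \<delta> by (simp add: ennreal_less_one_iff field_simps)
      from drift_le[OF _ \<delta> this] R h show "h \<in> {h \<in> space (hist m). \<forall>g\<in>G. drift m h g \<le> R}"
        by force
    qed
  qed
  finally show ?thesis .
qed

end

theorem theorem3p7:
  fixes X :: "'x measure"
    and D :: "('x \<times> real) measure"
    and G :: "('x \<times> real \<Rightarrow> real) set"
    and \<pi> :: "nat \<Rightarrow> 'x history \<Rightarrow> 'x \<Rightarrow> real pmf"
    and m N :: nat and \<delta> \<eta> :: real
  assumes "m \<ge> 1" and "N \<ge> 1"
    and "prob_space D" and "sets D = sets (X \<Otimes>\<^sub>M count_space {0, 1})"
    and "finite G" and "G \<noteq> {}"
    and "G \<subseteq> (space X \<times> grid N) \<rightarrow>\<^sub>E {-1..1}"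
    and "G \<subseteq> borel_measurable (X \<Otimes>\<^sub>M count_space (grid N))"
    and "0 < \<delta>" and "\<delta> < 1"
    and "0 < \<eta>" and "\<eta> \<le> 1 / 4"
    and "approachability_algorithm X N G \<eta> m \<pi>"
  shows "measure (training_law X N D \<pi> m)
      {h \<in> space (training_law X N D \<pi> m). \<forall>g\<in>G.
         bias N D g (historical_predictor m \<pi> h)
           \<le> 5 * \<eta> * mass N D g (historical_predictor m \<pi> h)
             + (2 * ln (12 * real (card G) / \<delta>) + 2 * real m / (real N)\<^sup>2) / (\<eta> * real m)}
      \<ge> 1 - \<delta>"
proof -
  interpret approachability X D G \<pi> m N \<eta>
    by (intro approachability.intro assms)
  have "real (card G) > 0" using assms by (simp add: card_gt_0_iff)
  \<comment> \<open>The constants are relaxed to the stated ones: 2 to 12 inside the logarithm, and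
    1/8 to 2 in the discretization term.\<close>
  then have "2 * ln (2 * real (card G) / \<delta>) + real m / (8 * (real N)\<^sup>2)
      \<le> 2 * ln (12 * real (card G) / \<delta>) + 2 * real m / (real N)\<^sup>2"
    using assms by (intro add_mono mult_left_mono frac_le) (auto simp: divide_right_mono)
  with assms show ?thesis by (intro high_probability_bound)
qed

end
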